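(* Let $n$ be a square-free positive integer with $-n\equiv2,3\pmod4$ and let $\theta=\sqrt{-n}$ (in the upper half-plane). Let $N\geq2$ be an integer. (i) For $s\in\mathbb{Z}\setminus N\mathbb{Z}$, $$\frac{g_{\left[\begin{smallmatrix} 0 \\ s/N \end{smallmatrix}\right]}(\theta)}{g_{\left[\begin{smallmatrix} 0 \\ 1/N \end{smallmatrix}\right]}(\theta)}$$ is a real number. (ii) For $t\in\mathbb{Z}$, $$i\,e^{\frac{t}{2N}\pi i}\,\frac{g_{\left[\begin{smallmatrix} 1/2 \\ t/N \end{smallmatrix}\right]}(\theta)}{g_{\left[\begin{smallmatrix} 0 \\ 1/N \end{smallmatrix}\right]}(\theta)}$$ is a real number.
   Context: Siegel functions: for $\mathbf{r}=\left[\begin{smallmatrix} r_1 \\ r_2 \end{smallmatrix}\right]\in\mathbb{Q}^2\setminus\mathbb{Z}^2$ and $\tau$ in the upper half-plane, $$g_{\mathbf{r}}(\tau)=-q_\tau^{\frac12\mathbf{B}_2(r_1)}e^{\pi i r_2(r_1-1)}(1-q_z)\prod_{k=1}^\infty(1-q_\tau^k q_z)(1-q_\tau^k q_z^{-1}),$$ where $\mathbf{B}_2(X)=X^2-X+1/6$, $z=r_1\tau+r_2$, $q_w=e^{2\pi i w}$ and $q_\tau^{a}=e^{2\pi i a\tau}$ for $a\in\mathbb{Q}$. *)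

theory Defs
  imports
    "HOL-Analysis.Analysis"
    "HOL-Computational_Algebra.Squarefree"
    "HOL-Number_Theory.Cong"
begin

definition bernoulli2 :: "'a :: field_char_0 \<Rightarrow> 'a" where
  "bernoulli2 X = X\<^sup>2 - X + 1 / 6"

definition nome :: "complex \<Rightarrow> complex" where
  "nome w = exp (2 * of_real pi * \<i> * w)"

(* Rational powers of the nome are exponentials of the multiplied argument and not a
   principal-branch power of the number "nome \<tau>". *)
definition nome_pow :: "complex \<Rightarrow> rat \<Rightarrow> complex" where
  "nome_pow \<tau> a = exp (2 * of_real pi * \<i> * of_rat a * \<tau>)"

(* Meaningful for (r1, r2) not in \<int> \<times> \<int> and Im \<tau> > 0.
   The product over k \<ge> 1 is indexed from 0 here, hence the exponent Suc k. *)
definition siegel :: "rat \<Rightarrow> rat \<Rightarrow> complex \<Rightarrow> complex" where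
  "siegel r1 r2 \<tau> =
     (let q = nome \<tau>; qz = nome (of_rat r1 * \<tau> + of_rat r2) in
        - nome_pow \<tau> (bernoulli2 r1 / 2)
        * exp (of_real pi * \<i> * of_rat r2 * (of_rat r1 - 1))
        * (1 - qz)
        * (\<Prod>k. (1 - q ^ Suc k * qz) * (1 - q ^ Suc k * inverse qz)))"

end

theory Submission imports Defs begin

text \<open>
  The square of \<open>\<theta>\<close> is a negative real, so \<open>\<theta>\<close> lies on the positive imaginary axis. There
  \<open>q = e\<^sup>2\<^sup>\<pi>\<^sup>i\<^sup>\<theta>\<close> and all its rational powers are positive reals, so complex conjugation acts on the
  Siegel product only through the root of unity \<open>w = e\<^sup>2\<^sup>\<pi>\<^sup>i\<^sup>r\<close>, which it sends to \<open>1 / w\<close>.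

  For \<open>r\<^sub>1 = 0\<close> we have \<open>q\<^sub>z = w\<close>, so the two halves of each factor of the product are conjugate
  and the product is real, while the remaining factor
  \<open>e\<^sup>-\<^sup>\<pi>\<^sup>i\<^sup>r (1 - w) = - 2 i sin (\<pi> r)\<close> is purely imaginary (\<open>siegel_zero_imaginary\<close>). A quotient of
  two such values is real.

  For \<open>r\<^sub>1 = 1/2\<close> put \<open>p = e\<^sup>\<pi>\<^sup>i\<^sup>\<theta>\<close>, so that \<open>q = p\<^sup>2\<close> and \<open>q\<^sub>z = p w\<close>. The factor \<open>1 - q\<^sub>z\<close>
  completes the product to \<open>\<Prod> (1 - p\<^sup>m w) (1 - p\<^sup>m / w)\<close> over odd \<open>m\<close>, which is again a product of
  conjugate pairs; the only non-real part of the value is the phase \<open>e\<^sup>-\<^sup>\<pi>\<^sup>i\<^sup>r\<^sup>/\<^sup>2\<close>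
  (\<open>siegel_half_real\<close>). The factor \<open>e\<^sup>\<pi>\<^sup>i\<^sup>t\<^sup>/\<^sup>2\<^sup>N\<close> cancels this phase, and \<open>i\<close> compensates for the
  imaginary denominator.
\<close>

text \<open>
  Outside convergence \<open>prodinf\<close> is an unspecified number; this makes it the limit of the partial
  products, so that statements about them pass to the infinite product.
\<close>

lemma convergent_prod_siegel:
  fixes q z z' :: complex
  assumes "norm q < 1"
  shows "convergent_prod (\<lambda>k. (1 - q ^ Suc k * z) * (1 - q ^ Suc k * z'))"
proof -
  have *: "convergent_prod (\<lambda>k. 1 - q ^ Suc k * c)" for c
  proof -
    have "summable (\<lambda>k. norm q ^ k * (norm q * norm c))"
      using assms by (intro summable_mult2 summable_geometric) auto
    hence "summable (\<lambda>k. norm (- (q ^ Suc k * c)))"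
      by (simp add: norm_mult norm_power mult_ac)
    hence "convergent_prod (\<lambda>k. 1 + - (q ^ Suc k * c))"
      by (intro abs_convergent_prod_imp_convergent_prod summable_imp_abs_convergent_prod) simp
    thus ?thesis by simp
  qed
  show ?thesis by (intro convergent_prod_mult *)
qed

lemma one_minus_mult_cnj_real:
  assumes "x \<in> \<real>"
  shows "(1 - x * w) * (1 - x * cnj w) \<in> \<real>"
proof -
  have "(1 - x * w) * (1 - x * cnj w) = (1 - x * w) * cnj (1 - x * w)"
    using assms by (simp add: Reals_cnj_iff)
  thus ?thesis by (simp only: complex_mult_cnj Reals_of_real)
qed

lemma siegel_prodinf_real:
  fixes q w :: complex
  assumes "norm q < 1" "q \<in> \<real>"
  shows "(\<Prod>k. (1 - q ^ Suc k * w) * (1 - q ^ Suc k * cnj w)) \<in> \<real>"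
proof (rule Lim_in_closed_set[OF closed_complex_Reals])
  let ?f = "\<lambda>k. (1 - q ^ Suc k * w) * (1 - q ^ Suc k * cnj w)"
  show "(\<lambda>n. \<Prod>k\<le>n. ?f k) \<longlonglongrightarrow> prodinf ?f"
    using convergent_prod_siegel[OF assms(1)] by (rule convergent_prod_LIMSEQ)
  show "\<forall>\<^sub>F n in sequentially. (\<Prod>k\<le>n. ?f k) \<in> \<real>"
    by (intro always_eventually allI prod_in_Reals one_minus_mult_cnj_real Reals_power assms)
qed auto

text \<open>
  Moving the factors containing \<open>w\<close> by one index turns the partial product into a product of
  conjugate pairs, at the cost of one boundary factor, which tends to \<open>1\<close>.
\<close>

lemma siegel_prodinf_shifted_real:
  fixes p w :: complex
  assumes "norm p < 1" "p \<in> \<real>" "p \<noteq> 0"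
  shows "(1 - p * w) * (\<Prod>k. (1 - (p\<^sup>2) ^ Suc k * (p * w)) * (1 - (p\<^sup>2) ^ Suc k * (cnj w / p))) \<in> \<real>"
proof -
  define f where "f = (\<lambda>k. (1 - (p\<^sup>2) ^ Suc k * (p * w)) * (1 - (p\<^sup>2) ^ Suc k * (cnj w / p)))"
  define e where "e = (\<lambda>n. 1 - p ^ (2 * n + 1) * w)"
  define R where "R = (\<lambda>n. \<Prod>k<n. e k * (1 - p ^ (2 * k + 1) * cnj w))"
  have p2: "norm (p\<^sup>2) < 1"
    using assms(1) by (simp add: norm_power power_less_one_iff)
  have f: "f k = e (Suc k) * (1 - p ^ (2 * k + 1) * cnj w)" for k
  proof -
    have "(p\<^sup>2) ^ Suc k * (p * w) = p ^ (2 * Suc k + 1) * w"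
      by (simp only: flip: power_mult) simp
    moreover have "(p\<^sup>2) ^ Suc k * (cnj w / p) = p ^ (2 * k + 1) * cnj w"
      using assms(3) by (simp add: power2_eq_square power_mult_distrib power_mult)
    ultimately show ?thesis by (simp add: f_def e_def)
  qed
  have shift: "(1 - p * w) * (\<Prod>k<n. f k) = R n * e n" for n
  proof (induction n)
    case 0
    show ?case by (simp add: R_def e_def)
  next
    case (Suc n)
    have "(1 - p * w) * (\<Prod>k<Suc n. f k) = ((1 - p * w) * (\<Prod>k<n. f k)) * f n"
      by simp
    also have "\<dots> = R n * e n * (e (Suc n) * (1 - p ^ (2 * n + 1) * cnj w))"
      by (simp only: Suc.IH f[of n])
    also have "\<dots> = R (Suc n) * e (Suc n)" by (simp add: R_def mult_ac)
    finally show ?case .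
  qed
  have "convergent_prod f"
    unfolding f_def by (rule convergent_prod_siegel[OF p2])
  hence "(\<lambda>n. \<Prod>k<n. f k) \<longlonglongrightarrow> prodinf f"
    by (simp add: convergent_prod_has_prod has_prod_imp_tendsto')
  hence lim: "(\<lambda>n. R n * e n) \<longlonglongrightarrow> (1 - p * w) * prodinf f"
    unfolding shift[symmetric] by (rule tendsto_mult_left)
  have "(\<lambda>n. 1 - (p\<^sup>2) ^ n * (p * w)) \<longlonglongrightarrow> 1 - 0 * (p * w)"
    by (intro tendsto_intros LIMSEQ_power_zero p2)
  hence e1: "e \<longlonglongrightarrow> 1"
    unfolding e_def by (simp add: mult.assoc mult.left_commute flip: power_mult)
  hence "\<forall>\<^sub>F n in sequentially. e n \<noteq> 0"
    by (rule tendsto_imp_eventually_ne) simp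
  hence ev: "\<forall>\<^sub>F n in sequentially. R n * e n / e n = R n"
    by eventually_elim simp
  have "(\<lambda>n. R n * e n / e n) \<longlonglongrightarrow> (1 - p * w) * prodinf f / 1"
    by (intro tendsto_divide lim e1) simp
  hence "R \<longlonglongrightarrow> (1 - p * w) * prodinf f"
    using Lim_transform_eventually[OF _ ev] by simp
  moreover have "R n \<in> \<real>" for n
    unfolding R_def e_def
    by (intro prod_in_Reals one_minus_mult_cnj_real Reals_power assms)
  ultimately have "(1 - p * w) * prodinf f \<in> \<real>"
    by (intro Lim_in_closed_set[OF closed_complex_Reals]) auto
  thus ?thesis by (simp only: f_def)
qed

lemma exp_imaginary_axis_real:
  assumes "Re \<tau> = 0" "c \<in> \<real>"
  shows "exp (c * \<i> * \<tau>) \<in> \<real>"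
proof -
  have "\<tau> = \<i> * of_real (Im \<tau>)" using assms(1) by (simp add: complex_eq_iff)
  hence "c * \<i> * \<tau> = - (c * of_real (Im \<tau>))"
    by (metis i_squared mult.assoc mult.commute mult_minus1)
  thus ?thesis using assms(2) by simp
qed

lemma of_rat_complex_real: "(of_rat a :: complex) \<in> \<real>"
  by (cases a) (simp add: of_rat_rat)

lemma nome_pow_real:
  assumes "Re \<tau> = 0"
  shows "nome_pow \<tau> a \<in> \<real>"
  using exp_imaginary_axis_real[OF assms, of "2 * of_real pi * of_rat a"]
  by (simp add: nome_pow_def of_rat_complex_real mult_ac)

lemma nome_real:
  assumes "Re \<tau> = 0"
  shows "nome \<tau> \<in> \<real>"
  using nome_pow_real[OF assms, of 1] by (simp add: nome_pow_def nome_def)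

lemma norm_nome_less_1:
  assumes "Im \<tau> > 0"
  shows "norm (nome \<tau>) < 1"
  using assms by (simp add: nome_def)

lemma nome_add: "nome (x + y) = nome x * nome y"
  by (simp add: nome_def exp_add ring_distribs)

lemma inverse_nome_of_real: "x \<in> \<real> \<Longrightarrow> inverse (nome x) = cnj (nome x)"
  by (simp add: nome_def exp_cnj exp_minus Reals_cnj_iff)

lemma siegel_zero_imaginary:
  assumes "Re \<tau> = 0" "Im \<tau> > 0"
  shows "\<i> * siegel 0 r \<tau> \<in> \<real>"
proof -
  define w where "w = nome (of_rat r)"
  define P where "P = (\<Prod>k. (1 - nome \<tau> ^ Suc k * w) * (1 - nome \<tau> ^ Suc k * cnj w))"
  have w': "inverse w = cnj w"
    by (simp add: w_def inverse_nome_of_real of_rat_complex_real)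
  have P: "P \<in> \<real>"
    unfolding P_def by (rule siegel_prodinf_real[OF norm_nome_less_1[OF assms(2)] nome_real[OF assms(1)]])
  define u where "u = exp (of_real pi * \<i> * of_rat r)"
  have w: "w = u * u" by (simp add: w_def u_def nome_def mult_ac flip: exp_add)
  have "inverse u * (1 - w) = inverse u - u"
    by (simp add: w u_def field_simps)
  also have "\<dots> = - 2 * \<i> * sin (of_real pi * of_rat r)"
    by (simp add: u_def sin_exp_eq exp_minus mult_ac field_simps)
  finally have sine: "inverse u * (1 - w) = - 2 * \<i> * sin (of_real pi * of_rat r)" .
  have "siegel 0 r \<tau> = - nome_pow \<tau> (bernoulli2 0 / 2) * (inverse u * (1 - w)) * P"
    by (simp add: siegel_def Let_def P_def w' u_def exp_minus flip: w_def)
  hence "\<i> * siegel 0 r \<tau>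
      = - 2 * nome_pow \<tau> (bernoulli2 0 / 2) * sin (of_real pi * of_rat r) * P"
    unfolding sine using i_squared by algebra
  moreover have "sin (of_real pi * of_rat r :: complex) \<in> \<real>"
  proof -
    from of_rat_complex_real[of r] obtain x where "of_rat r = complex_of_real x"
      by (rule Reals_cases)
    hence "sin (of_real pi * of_rat r :: complex) = of_real (sin (pi * x))"
      by (simp only: flip: sin_of_real of_real_mult)
    thus ?thesis by (simp only: Reals_of_real)
  qed
  ultimately show ?thesis
    using nome_pow_real[OF assms(1)] P by simp
qed

lemma siegel_half_real:
  assumes "Re \<tau> = 0" "Im \<tau> > 0"
  shows "exp (of_real pi * \<i> * of_rat r / 2) * siegel (1 / 2) r \<tau> \<in> \<real>"
proof -
  define w where "w = nome (of_rat r)"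
  define p where "p = nome (\<tau> / 2)"
  have "inverse w = cnj w"
    by (simp add: w_def inverse_nome_of_real of_rat_complex_real)
  hence inv: "inverse (p * w) = cnj w / p" by (simp add: divide_inverse mult_ac)
  have q: "nome \<tau> = p\<^sup>2"
    using nome_add[of "\<tau> / 2" "\<tau> / 2"] by (simp add: p_def power2_eq_square)
  have qz: "nome (of_rat (1 / 2) * \<tau> + of_rat r) = p * w"
    by (simp add: p_def w_def nome_add of_rat_divide)
  define P where
    "P = (1 - p * w) * (\<Prod>k. (1 - (p\<^sup>2) ^ Suc k * (p * w)) * (1 - (p\<^sup>2) ^ Suc k * (cnj w / p)))"
  have "p \<noteq> 0" by (simp add: p_def nome_def)
  with assms have P: "P \<in> \<real>"
    unfolding P_def p_def
    by (intro siegel_prodinf_shifted_real norm_nome_less_1 nome_real) simp_all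
  have phase: "exp (of_real pi * \<i> * of_rat r / 2)
      * exp (of_real pi * \<i> * of_rat r * (of_rat (1 / 2) - 1)) = (1 :: complex)"
    by (simp add: of_rat_divide flip: exp_add)
  have "exp (of_real pi * \<i> * of_rat r / 2) * siegel (1 / 2) r \<tau>
      = - nome_pow \<tau> (bernoulli2 (1 / 2) / 2)
        * (exp (of_real pi * \<i> * of_rat r / 2)
           * exp (of_real pi * \<i> * of_rat r * (of_rat (1 / 2) - 1))) * P"
    unfolding siegel_def Let_def qz inv q P_def by (simp only: mult_ac mult_minus_left mult_minus_right)
  also have "\<dots> = - nome_pow \<tau> (bernoulli2 (1 / 2) / 2) * P"
    by (simp only: phase mult_1_right)
  finally show ?thesis
    using nome_pow_real[OF assms(1)] P by simp
qed

theorem lemma6p2: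
  fixes n N :: nat and \<theta> :: complex
  assumes "n > 0" and "squarefree n"
    and "[- int n = 2] (mod 4) \<or> [- int n = 3] (mod 4)"
    and "\<theta>\<^sup>2 = - of_nat n" and "Im \<theta> > 0"
    and "N \<ge> 2"
  shows "(\<forall>s::int. \<not> int N dvd s \<longrightarrow>
            siegel 0 (of_int s / of_nat N) \<theta> / siegel 0 (1 / of_nat N) \<theta> \<in> \<real>)
       \<and> (\<forall>t::int.
            \<i> * exp (of_int t / (2 * of_nat N) * of_real pi * \<i>)
              * (siegel (1 / 2) (of_int t / of_nat N) \<theta> / siegel 0 (1 / of_nat N) \<theta>) \<in> \<real>)"
proof -
  have "Im (\<theta>\<^sup>2) = 0" using assms(4) by simp
  with assms(5) have Re: "Re \<theta> = 0" by (simp add: power2_eq_square)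
  note imaginary = siegel_zero_imaginary[OF Re assms(5)]
  note half = siegel_half_real[OF Re assms(5)]
  have "siegel 0 r \<theta> / siegel 0 r' \<theta> \<in> \<real>" for r r'
    using Reals_divide[OF imaginary[of r] imaginary[of r']] by simp
  moreover have "\<i> * exp (of_int t / (2 * of_nat N) * of_real pi * \<i>)
      * (siegel (1 / 2) (of_int t / of_nat N) \<theta> / siegel 0 r \<theta>) \<in> \<real>" for t :: int and r
  proof -
    have arg: "of_real pi * \<i> * of_rat (of_int t / of_nat N) / 2
        = of_int t / (2 * of_nat N) * of_real pi * (\<i> :: complex)"
      by (simp add: of_rat_divide mult_ac)
    have "\<i> * a * (b / c) = - (a * b / (\<i> * c))" for a b c :: complex
      by (simp add: divide_inverse mult_ac)
    thus ?thesis
      using Reals_divide[OF half[of "of_int t / of_nat N"] imaginary[of r]]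
      unfolding arg by (simp only: Reals_minus)
  qed
  ultimately show ?thesis by blast
qed

end
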